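(* Fix $n$. Let $\mathcal{R}\subseteq\mathbb{R}^n$ denote the set of all expected degree sequences of random graphs following the law $\mathbb{P}_{\boldsymbol{\beta}}$ as $\boldsymbol{\beta}$ ranges over $\mathbb{R}^n$. Let $\mathcal{D}\subseteq\mathbb{R}^n$ denote the set of all possible degree sequences of undirected (simple) graphs on $n$ vertices. Then $$\operatorname{conv}(\mathcal{D})=\overline{\mathcal{R}},$$ where $\operatorname{conv}(\mathcal{D})$ denotes the convex hull of $\mathcal{D}$ and $\overline{\mathcal{R}}$ is the topological closure of $\mathcal{R}$.
   Context: For $\boldsymbol{\beta}=(\beta_1,\ldots,\beta_n)\in\mathbb{R}^n$, $\mathbb{P}_{\boldsymbol{\beta}}$ is the law of the undirected random graph on vertices $1,\ldots,n$ in which, for each $1\le i\ne j\le n$, an edge is placed between $i$ and $j$ with probability $p_{ij}=\frac{e^{\beta_i+\beta_j}}{1+e^{\beta_i+\beta_j}}$, independently of all other edges. Its expected degree sequence is the vector whose $i$th coordinate is $\sum_{j\ne i}p_{ij}$. Degree sequences are vectors $(d_1,\ldots,d_n)$ with $d_i$ the degree of vertex $i$ (not required to be sorted). *)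

theory Defs
  imports "HOL-Probability.Probability"
begin

text \<open>The vertex set \<open>{1, \<dots>, n}\<close> is a finite type \<open>'n\<close> with \<open>n = CARD('n)\<close>; a simple graph on
  it is given by its edge set, a set of two-element vertex sets.\<close>

definition all_edges :: "'n::finite set set" where
  "all_edges = {e. card e = 2}"

definition simple_graph :: "'n::finite set set \<Rightarrow> bool" where
  "simple_graph E \<longleftrightarrow> E \<subseteq> all_edges"

definition degree_sequence :: "'n::finite set set \<Rightarrow> real ^ 'n" where
  "degree_sequence E = (\<chi> i. real (card {e \<in> E. i \<in> e}))"

definition edge_prob :: "real ^ 'n::finite \<Rightarrow> 'n \<Rightarrow> 'n \<Rightarrow> real" where
  "edge_prob \<beta> i j = exp (\<beta> $ i + \<beta> $ j) / (1 + exp (\<beta> $ i + \<beta> $ j))"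

text \<open>The sum over \<open>e\<close> makes the edge probability manifestly a function of the unordered pair;
  \<open>edge_set_prob_doubleton\<close> below identifies it with \<open>edge_prob\<close>.\<close>

definition edge_set_prob :: "real ^ 'n::finite \<Rightarrow> 'n set \<Rightarrow> real" where
  "edge_set_prob \<beta> e = exp (\<Sum>k\<in>e. \<beta> $ k) / (1 + exp (\<Sum>k\<in>e. \<beta> $ k))"

definition graph_law :: "real ^ 'n::finite \<Rightarrow> 'n set set pmf" where
  "graph_law \<beta> =
     map_pmf (\<lambda>\<omega>. {e \<in> all_edges. \<omega> e})
       (Pi_pmf all_edges False (\<lambda>e. bernoulli_pmf (edge_set_prob \<beta> e)))"

definition expected_degree_sequence :: "real ^ 'n::finite \<Rightarrow> real ^ 'n" where
  "expected_degree_sequence \<beta> =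
     (\<chi> i. measure_pmf.expectation (graph_law \<beta>) (\<lambda>E. degree_sequence E $ i))"

lemma edge_set_prob_doubleton:
  "i \<noteq> j \<Longrightarrow> edge_set_prob \<beta> {i, j} = edge_prob \<beta> i j"
  by (simp add: edge_set_prob_def edge_prob_def)

lemma edge_set_prob_bounds: "0 \<le> edge_set_prob \<beta> e" "edge_set_prob \<beta> e \<le> 1"
  by (auto simp: edge_set_prob_def divide_simps add_pos_pos intro: add_nonneg_nonneg)

text \<open>The law really lives on simple graphs, and the expected degrees are the sums
  \<open>\<Sum>\<^bsub>j \<noteq> i\<^esub> p\<^bsub>ij\<^esub>\<close>.\<close>

lemma simple_graph_graph_law: "E \<in> set_pmf (graph_law \<beta>) \<Longrightarrow> simple_graph E"
  by (auto simp: graph_law_def simple_graph_def)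

lemma prob_edge_graph_law:
  assumes "e \<in> all_edges"
  shows "measure_pmf.prob (graph_law \<beta>) {E. e \<in> E} = edge_set_prob \<beta> e"
proof -
  let ?P = "Pi_pmf all_edges False (\<lambda>e. bernoulli_pmf (edge_set_prob \<beta> e))"
  have "measure_pmf.prob (graph_law \<beta>) {E. e \<in> E} = measure_pmf.prob ?P ((\<lambda>\<omega>. \<omega> e) -` {True})"
    using assms by (simp add: graph_law_def vimage_def)
  also have "\<dots> = pmf (map_pmf (\<lambda>\<omega>. \<omega> e) ?P) True"
    by (simp add: pmf_map)
  also have "\<dots> = edge_set_prob \<beta> e"
    using assms by (simp add: Pi_pmf_component edge_set_prob_bounds)
  finally show ?thesis .
qed

lemma incident_edges: "{e \<in> all_edges. i \<in> e} = (\<lambda>j. {i, j}) ` (UNIV - {i})"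
  for i :: "'n::finite"
  by (auto simp: all_edges_def card_2_iff doubleton_eq_iff image_iff)

lemma expected_degree_sequence_nth:
  "expected_degree_sequence \<beta> $ i = (\<Sum>j\<in>UNIV - {i}. edge_prob \<beta> i j)"
  for \<beta> :: "real ^ 'n::finite"
proof -
  let ?M = "measure_pmf (graph_law \<beta>)"
  let ?I = "{e \<in> all_edges. i \<in> e}"
  have deg: "degree_sequence E $ i = (\<Sum>e\<in>?I. indicator {E. e \<in> E} E)"
    if "E \<in> set_pmf (graph_law \<beta>)" for E
  proof -
    have "{e \<in> E. i \<in> e} = {e \<in> ?I. e \<in> E}"
      using simple_graph_graph_law[OF that] by (auto simp: simple_graph_def)
    then show ?thesis
      by (simp add: degree_sequence_def indicator_def sum.If_cases Int_def)
  qed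
  have "expected_degree_sequence \<beta> $ i = (\<integral>E. (\<Sum>e\<in>?I. indicator {E. e \<in> E} E) \<partial>?M)"
    unfolding expected_degree_sequence_def
    using deg by (auto intro!: integral_cong_AE simp: AE_measure_pmf_iff)
  also have "\<dots> = (\<Sum>e\<in>?I. measure_pmf.prob (graph_law \<beta>) {E. e \<in> E})"
    by (subst Bochner_Integration.integral_sum)
       (auto intro!: integrable_measure_pmf_finite)
  also have "\<dots> = (\<Sum>e\<in>?I. edge_set_prob \<beta> e)"
    by (intro sum.cong) (auto simp: prob_edge_graph_law)
  also have "\<dots> = (\<Sum>j\<in>UNIV - {i}. edge_set_prob \<beta> {i, j})"
    unfolding incident_edges
    by (subst sum.reindex) (auto simp: inj_on_def doubleton_eq_iff)
  also have "\<dots> = (\<Sum>j\<in>UNIV - {i}. edge_prob \<beta> i j)"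
    by (intro sum.cong) (auto simp: edge_set_prob_doubleton)
  finally show ?thesis .
qed

end

theory Submission
  imports Defs
begin

text \<open>
  An expected degree sequence is an average of degree sequences, so it lies in the convex hull of
  the finite set of degree sequences; that hull is compact, so the closure stays inside it.

  For the converse, write \<open>A \<beta> = \<Sum>\<^bsub>i<j\<^esub> ln (1 + exp (\<beta>\<^sub>i + \<beta>\<^sub>j))\<close> for the log-partition function
  of the exponential family. Its gradient at \<open>\<beta>\<close> is the expected degree sequence
  (\<open>log_partition_has_derivative\<close>), and it dominates \<open>\<beta> \<bullet> y\<close> for every point \<open>y\<close> of the hull
  (\<open>inner_hull_le_log_partition\<close>), so \<open>A \<beta> - \<beta> \<bullet> y\<close> is bounded below. It need not attain its
  infimum: when \<open>y\<close> is on the boundary of the hull, minimizing sequences escape to infinity.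
  Adding a penalty \<open>\<epsilon>/2 \<cdot> \<parallel>\<beta>\<parallel>\<^sup>2\<close> forces a minimizer to exist, and at it the gradient of \<open>A\<close> differs
  from \<open>y\<close> by \<open>\<epsilon> \<beta>\<close>, whose norm is of order \<open>\<surd>\<epsilon>\<close> (\<open>in_closure_range_gradient\<close>). Letting
  \<open>\<epsilon>\<close> tend to \<open>0\<close> puts \<open>y\<close> in the closure. This treats interior and boundary points of the hull
  alike, whatever its dimension.
\<close>

text \<open>In the language of convex analysis, the hypothesis says that the convex conjugate of \<open>A\<close> is
  finite at \<open>y\<close>, so the closure of the range of the gradient contains the domain of the
  conjugate. The penalized function \<open>A x - x \<bullet> y + \<epsilon>/2 \<cdot> \<parallel>x\<parallel>\<^sup>2\<close> is coercive, and comparing its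
  minimum with its value at \<open>0\<close> bounds \<open>\<epsilon> \<parallel>x\<parallel>\<^sup>2\<close> at the minimizer independently of \<open>\<epsilon>\<close>.\<close>

lemma in_closure_range_gradient:
  fixes A :: "'a::euclidean_space \<Rightarrow> real" and F :: "'a \<Rightarrow> 'a"
  assumes deriv: "\<And>x. (A has_derivative (\<lambda>h. F x \<bullet> h)) (at x)"
    and bound: "\<And>x. x \<bullet> y \<le> A x + C"
  shows "y \<in> closure (range F)"
  unfolding closure_approachable
proof (intro allI impI)
  fix \<delta> :: real
  assume "\<delta> > 0"
  define M where "M = A 0 + C"
  have "M \<ge> 0"
    using bound[of 0] by (simp add: M_def)
  \<comment> \<open>chosen so that \<open>2 \<epsilon> M < \<delta>\<^sup>2\<close>, the left side being the bound on the squared gradient error\<close>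
  define \<epsilon> where "\<epsilon> = \<delta>\<^sup>2 / (2 * (M + 1))"
  have "\<epsilon> > 0"
    using \<open>\<delta> > 0\<close> \<open>M \<ge> 0\<close> by (simp add: \<epsilon>_def)
  have small: "2 * \<epsilon> * M < \<delta>\<^sup>2"
    using \<open>\<delta> > 0\<close> \<open>M \<ge> 0\<close> by (simp add: \<epsilon>_def field_simps)
  define G where "G x = A x - x \<bullet> y + \<epsilon> / 2 * (x \<bullet> x)" for x
  have G_deriv: "(G has_derivative (\<lambda>h. (F x - y + \<epsilon> *\<^sub>R x) \<bullet> h)) (at x)" for x
    unfolding G_def
    by (auto intro!: derivative_eq_intros deriv simp: algebra_simps inner_commute)
  have sublevel: "\<epsilon> * (norm x)\<^sup>2 \<le> 2 * M" if "G x \<le> G 0" for x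
    using that bound[of x] by (simp add: G_def M_def power2_norm_eq_inner)
  define r where "r = sqrt (2 * M / \<epsilon>)"
  have in_ball: "x \<in> cball 0 r" if "G x \<le> G 0" for x
    using sublevel[OF that] \<open>\<epsilon> > 0\<close> by (auto simp: r_def field_simps intro: real_le_rsqrt)
  have "continuous_on (cball 0 r) G"
    using G_deriv has_derivative_continuous continuous_at_imp_continuous_on by blast
  then obtain m where m: "\<And>x. x \<in> cball 0 r \<Longrightarrow> G m \<le> G x"
    using continuous_attains_inf[of "cball 0 r" G] in_ball[of 0] compact_cball by blast
  have "G m \<le> G 0"
    using m in_ball by blast
  have min: "G m \<le> G x" for x
    using m[of x] in_ball[of x] \<open>G m \<le> G 0\<close> by linarith
  have "(\<lambda>h. (F m - y + \<epsilon> *\<^sub>R m) \<bullet> h) = (\<lambda>h. 0)"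
    by (rule has_derivative_local_min[OF G_deriv]) (simp add: min)
  then have "F m - y + \<epsilon> *\<^sub>R m = 0"
    by (metis inner_eq_zero_iff)
  then have err: "F m - y = - (\<epsilon> *\<^sub>R m)"
    by (simp add: eq_neg_iff_add_eq_0)
  have "(dist (F m) y)\<^sup>2 = \<epsilon> * (\<epsilon> * (norm m)\<^sup>2)"
    by (simp add: dist_norm err power_mult_distrib power2_eq_square)
  also have "\<dots> \<le> \<epsilon> * (2 * M)"
    using sublevel[OF \<open>G m \<le> G 0\<close>] \<open>\<epsilon> > 0\<close> by (intro mult_left_mono) auto
  also have "\<dots> < \<delta>\<^sup>2"
    using small by (simp add: mult_ac)
  finally have "dist (F m) y < \<delta>"
    using \<open>\<delta> > 0\<close> by (simp add: power_less_imp_less_base)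
  then show "\<exists>z\<in>range F. dist z y < \<delta>"
    by blast
qed

text \<open>Double counting of the incidences \<open>k \<in> e\<close>: it turns sums over edges of vertex weights into
  inner products with (weighted) degree vectors.\<close>

lemma sum_incidence_swap:
  fixes S :: "'n::finite set set" and w :: "'n set \<Rightarrow> real" and h :: "'n \<Rightarrow> real"
  shows "(\<Sum>e\<in>S. w e * (\<Sum>k\<in>e. h k)) = (\<Sum>k\<in>UNIV. (\<Sum>e\<in>{e \<in> S. k \<in> e}. w e) * h k)"
  using sum.swap_restrict[of S "UNIV :: 'n set" "\<lambda>e k. w e * h k" "\<lambda>e k. k \<in> e"]
  by (simp add: sum_distrib_left sum_distrib_right)

lemma inner_degree_sequence:
  "\<beta> \<bullet> degree_sequence E = (\<Sum>e\<in>E. \<Sum>k\<in>e. \<beta> $ k)"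
  using sum_incidence_swap[of "\<lambda>_. 1" "\<lambda>k. \<beta> $ k" E]
  by (simp add: inner_vec_def degree_sequence_def mult.commute)

lemma expected_degree_sequence_nth_edges:
  "expected_degree_sequence \<beta> $ i = (\<Sum>e\<in>{e \<in> all_edges. i \<in> e}. edge_set_prob \<beta> e)"
proof -
  have "(\<Sum>e\<in>{e \<in> all_edges. i \<in> e}. edge_set_prob \<beta> e)
      = (\<Sum>j\<in>UNIV - {i}. edge_set_prob \<beta> {i, j})"
    unfolding incident_edges
    by (subst sum.reindex) (auto simp: inj_on_def doubleton_eq_iff)
  also have "\<dots> = (\<Sum>j\<in>UNIV - {i}. edge_prob \<beta> i j)"
    by (intro sum.cong) (auto simp: edge_set_prob_doubleton)
  finally show ?thesis
    by (simp add: expected_degree_sequence_nth)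
qed

definition log_partition :: "real ^ 'n::finite \<Rightarrow> real" where
  "log_partition \<beta> = (\<Sum>e\<in>all_edges. ln (1 + exp (\<Sum>k\<in>e. \<beta> $ k)))"

text \<open>The logistic function is the derivative of \<open>t \<mapsto> ln (1 + exp t)\<close>, so each edge \<open>e\<close>
  contributes its probability times the indicator vector of its two endpoints to the gradient.\<close>

lemma log_partition_has_derivative:
  "(log_partition has_derivative (\<lambda>h. expected_degree_sequence \<beta> \<bullet> h)) (at \<beta>)"
proof -
  have edge: "((\<lambda>\<beta>. ln (1 + exp (\<Sum>k\<in>e. \<beta> $ k))) has_derivative
      (\<lambda>h. edge_set_prob \<beta> e * (\<Sum>k\<in>e. h $ k))) (at \<beta>)" for e
    by (auto intro!: derivative_eq_intros bounded_linear_imp_has_derivative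
        bounded_linear_vec_nth simp: edge_set_prob_def field_simps add_pos_pos)
  have "((\<lambda>\<beta>. \<Sum>e\<in>all_edges. ln (1 + exp (\<Sum>k\<in>e. \<beta> $ k))) has_derivative
      (\<lambda>h. \<Sum>e\<in>all_edges. edge_set_prob \<beta> e * (\<Sum>k\<in>e. h $ k))) (at \<beta>)"
    by (intro has_derivative_sum edge)
  then show ?thesis
    unfolding sum_incidence_swap
    by (simp add: log_partition_def[abs_def] inner_vec_def expected_degree_sequence_nth_edges)
qed

text \<open>The condition on \<open>y\<close> cuts out a half-space, so only degree sequences need checking; there
  \<open>ln (1 + exp t)\<close> exceeds both \<open>t\<close>, used on the edges of the graph, and \<open>0\<close>, used on the
  others.\<close>

lemma inner_hull_le_log_partition:
  assumes "y \<in> convex hull {degree_sequence E | E. simple_graph E}"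
  shows "\<beta> \<bullet> y \<le> log_partition \<beta>"
proof -
  have "\<beta> \<bullet> degree_sequence E \<le> log_partition \<beta>" if "simple_graph E" for E
  proof -
    have "(\<Sum>k\<in>e. \<beta> $ k) \<le> ln (1 + exp (\<Sum>k\<in>e. \<beta> $ k))" for e
      by (subst ln_ge_iff) (auto intro: add_pos_pos)
    then have "\<beta> \<bullet> degree_sequence E \<le> (\<Sum>e\<in>E. ln (1 + exp (\<Sum>k\<in>e. \<beta> $ k)))"
      by (simp add: inner_degree_sequence sum_mono)
    also have "\<dots> \<le> log_partition \<beta>"
      unfolding log_partition_def
      using that by (intro sum_mono2) (auto simp: simple_graph_def)
    finally show ?thesis .
  qed
  then have "convex hull {degree_sequence E | E. simple_graph E} \<subseteq> {y. \<beta> \<bullet> y \<le> log_partition \<beta>}"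
    by (intro hull_minimal convex_halfspace_le) auto
  with assms show ?thesis
    by auto
qed

lemma expected_degree_sequence_in_hull:
  "expected_degree_sequence \<beta> \<in> convex hull {degree_sequence E | E. simple_graph E}"
proof -
  let ?p = "graph_law \<beta>"
  have "expected_degree_sequence \<beta> = (\<Sum>E\<in>set_pmf ?p. pmf ?p E *\<^sub>R degree_sequence E)"
    unfolding expected_degree_sequence_def
    by (simp add: vec_eq_iff integral_measure_pmf[of "set_pmf ?p"])
  also have "\<dots> \<in> convex hull {degree_sequence E | E. simple_graph E}"
    by (intro convex_sum convex_convex_hull hull_inc)
       (auto simp: sum_pmf_eq_1 dest: simple_graph_graph_law)
  finally show ?thesis .
qed

theorem theorem1p4:
  shows "convex hull {degree_sequence E | E :: 'n::finite set set. simple_graph E}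
       = closure (range (expected_degree_sequence :: real ^ 'n \<Rightarrow> real ^ 'n))"
proof
  let ?D = "{degree_sequence E | E :: 'n set set. simple_graph E}"
  show "convex hull ?D \<subseteq> closure (range expected_degree_sequence)"
  proof
    fix y
    assume "y \<in> convex hull ?D"
    then show "y \<in> closure (range expected_degree_sequence)"
      using in_closure_range_gradient[OF log_partition_has_derivative, of y 0]
      by (simp add: inner_hull_le_log_partition)
  qed
  have "finite ?D"
    by simp
  then have "closed (convex hull ?D)"
    by (intro compact_imp_closed compact_convex_hull finite_imp_compact)
  then show "closure (range expected_degree_sequence) \<subseteq> convex hull ?D"
    by (intro closure_minimal) (auto intro: expected_degree_sequence_in_hull)
qed

end
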